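(* Let $G$ be a finite simple graph on $N$ vertices, $\mathcal G$ a subgroup of its automorphism group, $k\ge N$ an integer, and $o_1,\dots,o_p$ the orbits described in the context. For $o_i,o_j$ and a representative $c\in o_i$, let $L_{o_i,o_j}(k)$ be the number of proper $k$-colorings of $G\times P_2$ whose restriction to $G\times\{1\}$ equals $c$ and whose restriction to $G\times\{2\}$ lies in $o_j$. Then: (1) $L_{o_i,o_j}(k)$ equals a sum of Ehrhart polynomials of lattice inside-out polytopes of dimension $s_j$, where $s_j$ is the number of colors used by the colorings in $o_j$, and hence is a polynomial in $k$ of degree $s_j$; (2) $L_{o_i,o_j}(k)$ does not depend on the choice of the representative $c\in o_i$; (3) $\#o_i\cdot L_{o_i,o_j}(k)=\chi_{G_{o_i,o_j}}(k)$, where $\#o_i$ is the number of colorings in $o_i$ and $\chi_{G_{o_i,o_j}}(k)$ is the number of proper $k$-colorings of $G\times P_2$ whose restriction to $G\times\{1\}$ lies in $o_i$ and whose restriction to $G\times\{2\}$ lies in $o_j$.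
   Context: A proper $k$-coloring of a graph is a map from its vertices to $[k]=\{1,\dots,k\}$ giving adjacent vertices different colors. Let $\mathcal C$ be the set of proper $k$-colorings of $G$. $\mathfrak S_k$ acts on $\mathcal C$ by permuting colors, with orbits $\tilde o_1,\dots,\tilde o_q$ (each corresponds to a partition of $V(G)$ into independent sets, the color classes; all colorings in one orbit use the same number of colors). $\mathcal G$ acts on $\mathcal C$ by $c\mapsto c\circ\sigma^{-1}$ and hence permutes the $\tilde o$'s; the orbits of this action are $o_1,\dots,o_p$, each identified with the set of colorings in the $\tilde o$'s it contains. $P_2$ is the path with vertices $1,2$ and $G\times P_2$ the Cartesian product (vertex set $V(G)\times\{1,2\}$, $(u,a)\sim(v,b)$ iff $u=v,\ a\neq b$, or $a=b,\ uv\in E(G)$). A lattice inside-out polytope is a pair $(P,\mathcal H)$ of a lattice polytope $P$ and a rational hyperplane arrangement $\mathcal H$ in its affine hull; its (open) Ehrhart polynomial counts the integer points of $t\big(\operatorname{relint}P\setminus\bigcup\mathcal H\big)$.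
   Formalization: In (1) the inside-out polytopes have dimension at most s_j, with s_j attained by at least one, and their Ehrhart polynomials are evaluated at k-s_i+1 (s_i = number of colors used in o_i); with all of dimension s_j the claim fails, e.g. for K_2, where L=k^2-3k+3. *)

theory Defs
  imports "HOL-Analysis.Analysis" "HOL-Algebra.Sym_Groups" "HOL-Algebra.Group_Action"
    "Graph_Theory.Pair_Digraph"
begin

text \<open>
  A finite simple graph is a \<open>pair_graph\<close>: a finite, symmetric, loop-free set of arcs (ordered
  pairs) on a finite vertex set.
\<close>

section \<open>Colorings and Cartesian products\<close>

text \<open>Colorings are extensional on the vertex set, so that they can be counted with \<open>card\<close>.\<close>

definition proper_colorings :: "'v pair_pre_digraph \<Rightarrow> nat \<Rightarrow> ('v \<Rightarrow> nat) set" where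
  "proper_colorings G k = {c \<in> pverts G \<rightarrow>\<^sub>E {1..k}. \<forall>(u, v) \<in> parcs G. c u \<noteq> c v}"

definition cartesian_prod ::
    "'v pair_pre_digraph \<Rightarrow> 'w pair_pre_digraph \<Rightarrow> ('v \<times> 'w) pair_pre_digraph" where
  "cartesian_prod G H =
    \<lparr> pverts = pverts G \<times> pverts H,
      parcs = {((u, a), (v, b)) | u a v b.
        (u = v \<and> u \<in> pverts G \<and> (a, b) \<in> parcs H) \<or>
        (a = b \<and> a \<in> pverts H \<and> (u, v) \<in> parcs G)} \<rparr>"

definition P2 :: "nat pair_pre_digraph" where
  "P2 = \<lparr> pverts = {1, 2}, parcs = {(1, 2), (2, 1)} \<rparr>"

definition restrict_copy :: "'v pair_pre_digraph \<Rightarrow> nat \<Rightarrow> ('v \<times> nat \<Rightarrow> nat) \<Rightarrow> 'v \<Rightarrow> nat" where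
  "restrict_copy G a f = (\<lambda>v \<in> pverts G. f (v, a))"


section \<open>Orbits of colorings\<close>

definition aut_group :: "'v pair_pre_digraph \<Rightarrow> ('v \<Rightarrow> 'v) monoid" where
  "aut_group G =
    \<lparr> carrier = {\<sigma>. \<sigma> permutes pverts G \<and>
        (\<forall>u \<in> pverts G. \<forall>v \<in> pverts G. (\<sigma> u, \<sigma> v) \<in> parcs G \<longleftrightarrow> (u, v) \<in> parcs G)},
      mult = (\<circ>), one = id \<rparr>"

definition color_action :: "'v pair_pre_digraph \<Rightarrow> (nat \<Rightarrow> nat) \<Rightarrow> ('v \<Rightarrow> nat) \<Rightarrow> 'v \<Rightarrow> nat" where
  "color_action G \<pi> c = (\<lambda>v \<in> pverts G. \<pi> (c v))"

definition vertex_action :: "('v \<Rightarrow> 'v) \<Rightarrow> ('v \<Rightarrow> nat) \<Rightarrow> 'v \<Rightarrow> nat" where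
  "vertex_action \<sigma> c = c \<circ> inv_into UNIV \<sigma>"

definition color_orbits :: "'v pair_pre_digraph \<Rightarrow> nat \<Rightarrow> ('v \<Rightarrow> nat) set set" where
  "color_orbits G k = orbits (sym_group k) (proper_colorings G k) (color_action G)"

text \<open>
  An orbit of the vertex action on \<open>color_orbits G k\<close> is a set of sets of colorings; it is
  identified with the union of its members.
\<close>

definition coloring_orbits ::
    "'v pair_pre_digraph \<Rightarrow> ('v \<Rightarrow> 'v) set \<Rightarrow> nat \<Rightarrow> ('v \<Rightarrow> nat) set set" where
  "coloring_orbits G \<G> k =
    \<Union> ` orbits (aut_group G\<lparr>carrier := \<G>\<rparr>) (color_orbits G k) (\<lambda>\<sigma>. image (vertex_action \<sigma>))"

definition colors_used :: "'v pair_pre_digraph \<Rightarrow> ('v \<Rightarrow> nat) set \<Rightarrow> nat" where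
  "colors_used G X = (THE s. \<exists>c \<in> X. card (c ` pverts G) = s)"

definition color_classes :: "'v pair_pre_digraph \<Rightarrow> ('v \<Rightarrow> nat) \<Rightarrow> 'v set set" where
  "color_classes G c = (\<lambda>i. {v \<in> pverts G. c v = i}) ` (c ` pverts G)"

text \<open>
  For \<open>k \<ge> card (pverts G)\<close> the orbits correspond to orbits of partitions of the vertex set into
  independent sets, whatever \<open>k\<close> is.  If \<open>X\<close> is an orbit of colorings with some number of colors,
  then \<open>orbit_at G k X\<close> is the corresponding orbit of \<open>k\<close>-colorings; this is what it means to vary
  \<open>k\<close> for a fixed orbit (see \<open>orbit_at_self\<close> and \<open>orbit_at_in_coloring_orbits\<close> below).
\<close>

definition orbit_at ::
    "'v pair_pre_digraph \<Rightarrow> nat \<Rightarrow> ('v \<Rightarrow> nat) set \<Rightarrow> ('v \<Rightarrow> nat) set" where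
  "orbit_at G k X = {c \<in> proper_colorings G k. color_classes G c \<in> color_classes G ` X}"

definition L_count ::
    "'v pair_pre_digraph \<Rightarrow> nat \<Rightarrow> ('v \<Rightarrow> nat) \<Rightarrow> ('v \<Rightarrow> nat) set \<Rightarrow> nat" where
  "L_count G k c Y =
    card {f \<in> proper_colorings (cartesian_prod G P2) k.
      restrict_copy G 1 f = c \<and> restrict_copy G 2 f \<in> Y}"

definition chi_count ::
    "'v pair_pre_digraph \<Rightarrow> nat \<Rightarrow> ('v \<Rightarrow> nat) set \<Rightarrow> ('v \<Rightarrow> nat) set \<Rightarrow> nat" where
  "chi_count G k X Y =
    card {f \<in> proper_colorings (cartesian_prod G P2) k.
      restrict_copy G 1 f \<in> X \<and> restrict_copy G 2 f \<in> Y}"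


text \<open>
  The orbits of colorings in terms of color classes: \<open>colors_used\<close> is well defined and
  \<open>orbit_at\<close> yields orbits.
\<close>

lemma color_classes_eq_iff:
  "color_classes G c = color_classes G d \<longleftrightarrow>
    (\<forall>u \<in> pverts G. \<forall>v \<in> pverts G. c u = c v \<longleftrightarrow> d u = d v)" (is "?l \<longleftrightarrow> ?r")
proof
  have *: "c u = c v \<longleftrightarrow> d u = d v"
    if eq: "color_classes G c = color_classes G d" and u: "u \<in> pverts G" and v: "v \<in> pverts G"
    for c d :: "'a \<Rightarrow> nat" and u v
  proof -
    have "{w \<in> pverts G. c w = c u} \<in> color_classes G d"
      unfolding eq[symmetric] using u by (auto simp: color_classes_def)
    then obtain i where "{w \<in> pverts G. c w = c u} = {w \<in> pverts G. d w = i}"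
      by (auto simp: color_classes_def)
    then show ?thesis using u v by (auto simp: set_eq_iff) metis+
  qed
  show "?l \<Longrightarrow> ?r" using * by blast
next
  assume r: ?r
  then have "{v \<in> pverts G. c v = c u} = {v \<in> pverts G. d v = d u}" if "u \<in> pverts G" for u
    using that by auto
  then show ?l unfolding color_classes_def image_image by (intro image_cong) auto
qed

lemma card_color_classes: "card (color_classes G c) = card (c ` pverts G)"
  unfolding color_classes_def by (rule card_image) (auto simp: inj_on_def)

lemma mem_proper_colorings:
  "c \<in> proper_colorings G k \<longleftrightarrow>
    (\<forall>v \<in> pverts G. c v \<in> {1..k}) \<and> (\<forall>v. v \<notin> pverts G \<longrightarrow> c v = undefined) \<and>
    (\<forall>u v. (u, v) \<in> parcs G \<longrightarrow> c u \<noteq> c v)"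
  unfolding proper_colorings_def PiE_def Pi_def extensional_def by blast

lemma mem_proper_coloringsI:
  assumes "c \<in> extensional (pverts G)" "c ` pverts G \<subseteq> {1..k}"
    and "d \<in> proper_colorings G k'" "pair_graph G"
    and "\<And>u v. u \<in> pverts G \<Longrightarrow> v \<in> pverts G \<Longrightarrow> c u = c v \<Longrightarrow> d u = d v"
  shows "c \<in> proper_colorings G k"
proof -
  interpret pair_graph G by fact
  have "c u \<noteq> c v" if "(u, v) \<in> parcs G" for u v
    using that assms(3) assms(5)[OF in_arcsD1[OF that] in_arcsD2[OF that]]
    unfolding mem_proper_colorings by blast
  moreover have "c v \<in> {1..k}" if "v \<in> pverts G" for v using that assms(2) by blast
  moreover have "c v = undefined" if "v \<notin> pverts G" for v
    using that assms(1) by (simp add: extensional_def)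
  ultimately show ?thesis unfolding mem_proper_colorings by blast
qed

lemma recolor:
  assumes fin: "finite (pverts G)" and k: "c ` pverts G \<subseteq> {1..k}" "d ` pverts G \<subseteq> {1..k}"
    and eq: "color_classes G c = color_classes G d"
  shows "\<exists>\<pi>. \<pi> permutes {1..k} \<and> (\<forall>v \<in> pverts G. d v = \<pi> (c v))"
proof -
  let ?V = "pverts G"
  define g where "g i = d (SOME v. v \<in> ?V \<and> c v = i)" for i
  have g: "g (c v) = d v" if "v \<in> ?V" for v
  proof -
    have "(SOME w. w \<in> ?V \<and> c w = c v) \<in> ?V \<and> c (SOME w. w \<in> ?V \<and> c w = c v) = c v"
      by (rule someI[of _ v]) (use that in auto)
    with that eq show ?thesis unfolding g_def color_classes_eq_iff by metis
  qed
  have b1: "bij_betw g (c ` ?V) (d ` ?V)"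
  proof -
    have "c u = c v" if "u \<in> ?V" "v \<in> ?V" "g (c u) = g (c v)" for u v
      using that eq g[of u] g[of v] unfolding color_classes_eq_iff by metis
    then have "inj_on g (c ` ?V)" by (auto simp: inj_on_def)
    moreover have "g ` c ` ?V = d ` ?V" unfolding image_image by (intro image_cong) (simp_all add: g)
    ultimately show ?thesis by (simp add: bij_betw_def)
  qed
  have "card (c ` ?V) = card (d ` ?V)" using b1 by (rule bij_betw_same_card)
  then have "card ({1..k} - c ` ?V) = card ({1..k} - d ` ?V)"
    using fin k by (simp add: card_Diff_subset)
  then obtain h where b2: "bij_betw h ({1..k} - c ` ?V) ({1..k} - d ` ?V)"
    using finite_same_card_bij[of "{1..k} - c ` ?V" "{1..k} - d ` ?V"] by auto
  define \<pi> where "\<pi> i = (if i \<in> {1..k} then if i \<in> c ` ?V then g i else h i else i)" for i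
  have "bij_betw \<pi> (c ` ?V) (d ` ?V)"
    using b1 k by (subst bij_betw_cong[where g = g]) (auto simp: \<pi>_def)
  moreover have "bij_betw \<pi> ({1..k} - c ` ?V) ({1..k} - d ` ?V)"
    using b2 by (subst bij_betw_cong[where g = h]) (auto simp: \<pi>_def)
  ultimately have "bij_betw \<pi> (c ` ?V \<union> ({1..k} - c ` ?V)) (d ` ?V \<union> ({1..k} - d ` ?V))"
    by (rule bij_betw_combine) auto
  then have "bij_betw \<pi> {1..k} {1..k}" using k by (simp add: Un_absorb1 Un_Diff_cancel)
  then have "\<pi> permutes {1..k}" by (rule bij_imp_permutes) (auto simp: \<pi>_def)
  moreover have "d v = \<pi> (c v)" if "v \<in> ?V" for v
    using that k g by (auto simp: \<pi>_def)
  ultimately show ?thesis by blast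
qed

lemma color_orbit_eq:
  assumes G: "pair_graph G" and c: "c \<in> proper_colorings G k"
  shows "orbit (sym_group k) (color_action G) c =
    {d \<in> proper_colorings G k. color_classes G d = color_classes G c}" (is "?l = ?r")
proof
  interpret pair_graph G by fact
  show "?l \<subseteq> ?r"
  proof
    fix d assume "d \<in> ?l"
    then obtain \<pi> where \<pi>: "\<pi> permutes {1..k}" and d: "d = color_action G \<pi> c"
      by (auto simp: orbit_def sym_group_def)
    have eq: "d u = d v \<longleftrightarrow> c u = c v" if "u \<in> pverts G" "v \<in> pverts G" for u v
      using that permutes_inj[OF \<pi>] by (auto simp: d color_action_def inj_eq)
    have "d \<in> proper_colorings G k"
    proof (rule mem_proper_coloringsI[OF _ _ c G])
      have "\<pi> (c v) \<in> {1..k}" if "v \<in> pverts G" for v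
        using that c unfolding permutes_in_image[OF \<pi>] mem_proper_colorings by blast
      then show "d ` pverts G \<subseteq> {1..k}"
        unfolding d color_action_def by (intro image_subsetI) (simp only: restrict_apply if_True)
      show "d \<in> extensional (pverts G)" by (simp add: d color_action_def)
    qed (simp add: eq)
    with eq show "d \<in> ?r" by (auto simp: color_classes_eq_iff)
  qed
  show "?r \<subseteq> ?l"
  proof
    fix d assume d: "d \<in> ?r"
    then obtain \<pi> where \<pi>: "\<pi> permutes {1..k}" "\<forall>v \<in> pverts G. d v = \<pi> (c v)"
      using recolor[of G c k d] pair_finite_verts c by (auto simp: proper_colorings_def)
    then have "d = color_action G \<pi> c"
      using d by (auto simp: color_action_def proper_colorings_def PiE_def extensional_def)
    with \<pi> show "d \<in> ?l" by (auto simp: orbit_def sym_group_def)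
  qed
qed

lemma vertex_action_proper:
  assumes "\<sigma> \<in> carrier (aut_group G)" "c \<in> proper_colorings G k" "pair_graph G"
  shows "vertex_action \<sigma> c \<in> proper_colorings G k"
proof -
  interpret pair_graph G by fact
  let ?i = "inv_into UNIV \<sigma>"
  have \<sigma>: "\<sigma> permutes pverts G" using assms(1) by (auto simp: aut_group_def)
  have i: "?i v \<in> pverts G \<longleftrightarrow> v \<in> pverts G" for v
    using permutes_in_image[OF permutes_inv[OF \<sigma>]] by auto
  have io: "v \<notin> pverts G \<Longrightarrow> ?i v = v" for v
    using permutes_inv[OF \<sigma>] by (auto simp: permutes_def)
  have "(?i u, ?i v) \<in> parcs G" if "(u, v) \<in> parcs G" for u v
  proof -
    have "(\<sigma> (?i u), \<sigma> (?i v)) \<in> parcs G" using that permutes_inverses(1)[OF \<sigma>] by simp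
    moreover have "?i u \<in> pverts G" "?i v \<in> pverts G"
      unfolding i using in_arcsD1[OF that] in_arcsD2[OF that] by blast+
    ultimately show ?thesis using assms(1) unfolding aut_group_def by auto
  qed
  with assms(2) i io show ?thesis
    unfolding mem_proper_colorings vertex_action_def o_apply by metis
qed

lemma color_classes_vertex_action:
  assumes "\<sigma> permutes pverts G"
  shows "color_classes G (vertex_action \<sigma> c) = image \<sigma> ` color_classes G c"
proof -
  let ?i = "inv_into UNIV \<sigma>"
  have im: "?i ` pverts G = pverts G" using permutes_image[OF permutes_inv[OF assms]] .
  have "{v \<in> pverts G. c (?i v) = j} = \<sigma> ` {v \<in> pverts G. c v = j}" for j
  proof -
    have "v \<in> \<sigma> ` {v \<in> pverts G. c v = j}" if "v \<in> pverts G" "c (?i v) = j" for v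
      using that permutes_in_image[OF permutes_inv[OF assms], of v] permutes_inverses(1)[OF assms, of v]
      by (intro image_eqI[of _ _ "?i v"]) auto
    moreover have "\<sigma> v \<in> pverts G \<and> ?i (\<sigma> v) = v" if "v \<in> pverts G" for v
      using that permutes_in_image[OF assms] permutes_inverses(2)[OF assms] by simp
    ultimately show ?thesis by auto
  qed
  moreover have "(c \<circ> ?i) ` pverts G = c ` pverts G" by (simp only: image_comp[symmetric] im)
  ultimately show ?thesis by (simp add: color_classes_def vertex_action_def image_image)
qed

lemma coloring_orbits_eq:
  assumes G: "pair_graph G" and S: "\<G> \<subseteq> carrier (aut_group G)"
  shows "coloring_orbits G \<G> k =
    (\<lambda>c. {d \<in> proper_colorings G k. \<exists>\<sigma> \<in> \<G>. color_classes G d = image \<sigma> ` color_classes G c})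
      ` proper_colorings G k"
proof -
  have 1: "vertex_action \<sigma> ` orbit (sym_group k) (color_action G) c =
      {d \<in> proper_colorings G k. color_classes G d = image \<sigma> ` color_classes G c}" (is "?l = ?r")
    if c: "c \<in> proper_colorings G k" and \<sigma>: "\<sigma> \<in> \<G>" for \<sigma> c
  proof
    have p: "\<sigma> permutes pverts G" using S \<sigma> by (auto simp: aut_group_def)
    show "?l \<subseteq> ?r"
      unfolding color_orbit_eq[OF G c]
      using vertex_action_proper[OF _ _ G] S \<sigma> color_classes_vertex_action[OF p] by auto
    show "?r \<subseteq> ?l"
    proof
      fix d assume d: "d \<in> ?r"
      have "vertex_action \<sigma> c \<in> proper_colorings G k"
        using vertex_action_proper[OF _ c G] S \<sigma> by auto
      with d have "d \<in> orbit (sym_group k) (color_action G) (vertex_action \<sigma> c)"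
        by (simp add: color_orbit_eq[OF G] color_classes_vertex_action[OF p])
      then obtain \<pi> where \<pi>: "\<pi> permutes {1..k}" and d: "d = color_action G \<pi> (vertex_action \<sigma> c)"
        by (auto simp: orbit_def sym_group_def)
      have "d = vertex_action \<sigma> (color_action G \<pi> c)"
        using permutes_in_image[OF permutes_inv[OF p]]
        by (auto simp: d color_action_def vertex_action_def fun_eq_iff)
      with \<pi> show "d \<in> ?l" by (auto simp: orbit_def sym_group_def)
    qed
  qed
  have 2: "\<Union> (orbit (aut_group G\<lparr>carrier := \<G>\<rparr>) (\<lambda>\<sigma>. image (vertex_action \<sigma>))
       (orbit (sym_group k) (color_action G) c)) =
     {d \<in> proper_colorings G k. \<exists>\<sigma> \<in> \<G>. color_classes G d = image \<sigma> ` color_classes G c}"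
    if c: "c \<in> proper_colorings G k" for c
  proof -
    have "\<Union> (orbit (aut_group G\<lparr>carrier := \<G>\<rparr>) (\<lambda>\<sigma>. image (vertex_action \<sigma>))
       (orbit (sym_group k) (color_action G) c)) =
      (\<Union>\<sigma> \<in> \<G>. vertex_action \<sigma> ` orbit (sym_group k) (color_action G) c)"
      unfolding orbit_def[of "aut_group G\<lparr>carrier := \<G>\<rparr>"] by auto
    also have "\<dots> = (\<Union>\<sigma> \<in> \<G>.
      {d \<in> proper_colorings G k. color_classes G d = image \<sigma> ` color_classes G c})"
      using 1[OF c] by simp
    finally show ?thesis by auto
  qed
  have "coloring_orbits G \<G> k =
    (\<lambda>c. \<Union> (orbit (aut_group G\<lparr>carrier := \<G>\<rparr>) (\<lambda>\<sigma>. image (vertex_action \<sigma>))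
       (orbit (sym_group k) (color_action G) c))) ` proper_colorings G k"
    unfolding coloring_orbits_def color_orbits_def orbits_def by blast
  also have "\<dots> =
    (\<lambda>c. {d \<in> proper_colorings G k. \<exists>\<sigma> \<in> \<G>. color_classes G d = image \<sigma> ` color_classes G c})
      ` proper_colorings G k"
    by (rule image_cong) (use 2 in auto)
  finally show ?thesis .
qed

lemma orbit_at_eq:
  assumes G: "pair_graph G" and S: "\<G> \<subseteq> carrier (aut_group G)"
    and c: "c \<in> proper_colorings G k"
    and X: "X = {d \<in> proper_colorings G k. \<exists>\<sigma> \<in> \<G>. color_classes G d = image \<sigma> ` color_classes G c}"
  shows "orbit_at G n X =
    {d \<in> proper_colorings G n. \<exists>\<sigma> \<in> \<G>. color_classes G d = image \<sigma> ` color_classes G c}"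
proof -
  have "image \<sigma> ` color_classes G c \<in> color_classes G ` X" if "\<sigma> \<in> \<G>" for \<sigma>
  proof -
    have "\<sigma> permutes pverts G" using S that by (auto simp: aut_group_def)
    then have *: "color_classes G (vertex_action \<sigma> c) = image \<sigma> ` color_classes G c"
      by (rule color_classes_vertex_action)
    moreover have "vertex_action \<sigma> c \<in> X"
      unfolding X using vertex_action_proper[OF _ c G] S that * by auto
    ultimately show ?thesis by (metis image_eqI)
  qed
  then have "color_classes G ` X = (\<lambda>\<sigma>. image \<sigma> ` color_classes G c) ` \<G>"
    unfolding X by auto
  then show ?thesis by (auto simp: orbit_at_def)
qed

lemma orbit_at_self:
  assumes "pair_graph G" "subgroup \<G> (aut_group G)" "X \<in> coloring_orbits G \<G> k"
  shows "orbit_at G k X = X"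
proof -
  have S: "\<G> \<subseteq> carrier (aut_group G)" using assms(2) by (rule subgroup.subset)
  obtain c where c: "c \<in> proper_colorings G k"
    and X: "X = {d \<in> proper_colorings G k. \<exists>\<sigma> \<in> \<G>. color_classes G d = image \<sigma> ` color_classes G c}"
    using assms(3) unfolding coloring_orbits_eq[OF assms(1) S] by auto
  show ?thesis unfolding orbit_at_eq[OF assms(1) S c X] by (rule X[symmetric])
qed

lemma orbit_at_in_coloring_orbits:
  assumes "pair_graph G" "subgroup \<G> (aut_group G)" "X \<in> coloring_orbits G \<G> k"
    and n: "n \<ge> card (pverts G)"
  shows "orbit_at G n X \<in> coloring_orbits G \<G> n"
proof -
  interpret pair_graph G by fact
  have S: "\<G> \<subseteq> carrier (aut_group G)" using assms(2) by (rule subgroup.subset)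
  obtain c where c: "c \<in> proper_colorings G k"
    and X: "X = {d \<in> proper_colorings G k. \<exists>\<sigma> \<in> \<G>. color_classes G d = image \<sigma> ` color_classes G c}"
    using assms(3) unfolding coloring_orbits_eq[OF assms(1) S] by auto
  have "card (c ` pverts G) \<le> card {1..n}"
    using n card_image_le[OF pair_finite_verts, of c] by simp
  then obtain h where h: "h ` c ` pverts G \<subseteq> {1..n}" "inj_on h (c ` pverts G)"
    using card_le_inj[of "c ` pverts G" "{1..n}"] pair_finite_verts by auto
  define d where "d = (\<lambda>v \<in> pverts G. h (c v))"
  have eq: "d u = d v \<longleftrightarrow> c u = c v" if "u \<in> pverts G" "v \<in> pverts G" for u v
    using that h(2) by (auto simp: d_def inj_on_def)
  have "d \<in> proper_colorings G n"
    by (rule mem_proper_coloringsI[OF _ _ c assms(1)]) (use h(1) eq in \<open>auto simp: d_def\<close>)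
  moreover have "color_classes G c = color_classes G d"
    using eq by (simp add: color_classes_eq_iff)
  ultimately show ?thesis
    unfolding coloring_orbits_eq[OF assms(1) S] orbit_at_eq[OF assms(1) S c X] by auto
qed

lemma colors_used_eq:
  assumes "pair_graph G" "subgroup \<G> (aut_group G)" "X \<in> coloring_orbits G \<G> k" "c \<in> X"
  shows "colors_used G X = card (c ` pverts G)"
proof -
  have S: "\<G> \<subseteq> carrier (aut_group G)" using assms(2) by (rule subgroup.subset)
  obtain b where
    X: "X = {d \<in> proper_colorings G k. \<exists>\<sigma> \<in> \<G>. color_classes G d = image \<sigma> ` color_classes G b}"
    using assms(3) unfolding coloring_orbits_eq[OF assms(1) S] by auto
  have "card (d ` pverts G) = card (color_classes G b)" if d: "d \<in> X" for d
  proof -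
    obtain \<sigma> where \<sigma>: "\<sigma> \<in> \<G>" "color_classes G d = image \<sigma> ` color_classes G b"
      using d X by auto
    then have "inj \<sigma>" using S by (auto simp: aut_group_def intro: permutes_inj)
    then have "inj_on (image \<sigma>) (color_classes G b)" by (auto simp: inj_on_def inj_image_eq_iff)
    then show ?thesis using \<sigma>(2) card_image card_color_classes[of G d] by metis
  qed
  with assms(4) show ?thesis unfolding colors_used_def by (intro the_equality) auto
qed


section \<open>Inside-out polytopes\<close>

definition integer_points :: "(real ^ 'n) set" where
  "integer_points = {x. \<forall>i. x $ i \<in> \<int>}"

definition lattice_polytope :: "(real ^ 'n) set \<Rightarrow> bool" where
  "lattice_polytope P \<longleftrightarrow>
    (\<exists>S. finite S \<and> S \<noteq> {} \<and> S \<subseteq> integer_points \<and> P = convex hull S)"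

definition rational_hyperplane_in :: "(real ^ 'n) set \<Rightarrow> (real ^ 'n) set \<Rightarrow> bool" where
  "rational_hyperplane_in A h \<longleftrightarrow>
    (\<exists>a b. (\<forall>i. a $ i \<in> \<rat>) \<and> b \<in> \<rat> \<and> h = {x \<in> A. a \<bullet> x = b}) \<and> aff_dim h = aff_dim A - 1"

definition lattice_inside_out_polytope :: "(real ^ 'n) set \<Rightarrow> (real ^ 'n) set set \<Rightarrow> bool" where
  "lattice_inside_out_polytope P H \<longleftrightarrow>
    lattice_polytope P \<and> finite H \<and> (\<forall>h \<in> H. rational_hyperplane_in (affine hull P) h)"

definition open_ehrhart :: "(real ^ 'n) set \<Rightarrow> (real ^ 'n) set set \<Rightarrow> nat \<Rightarrow> nat" where
  "open_ehrhart P H t =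
    card (integer_points \<inter> (\<lambda>x. real t *\<^sub>R x) ` (rel_interior P - \<Union>H))"

text \<open>
  For a lattice polytope with rational (not necessarily integral) hyperplanes the counting function
  is only a quasi-polynomial in general, so being a polynomial is part of the following predicate.
\<close>

definition open_ehrhart_polynomial ::
    "(real ^ 'n) set \<Rightarrow> (real ^ 'n) set set \<Rightarrow> real poly \<Rightarrow> bool" where
  "open_ehrhart_polynomial P H q \<longleftrightarrow>
    (\<forall>t \<ge> 1. poly q (real t) = real (open_ehrhart P H t))"

text \<open>
  The count for a fixed first coloring is a sum of such polynomials evaluated at
  \<open>k - s\<^sub>i + 1\<close>, where \<open>s\<^sub>i\<close> is the number of colors of the first coloring: fix which color classes of
  the second coloring reuse these \<open>s\<^sub>i\<close> colors, and count the injective colorings of the remaining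
  \<open>r\<close> classes by the other \<open>k - s\<^sub>i\<close> colors, which are the integer points of the dilated open \<open>r\<close>-cube
  off the hyperplanes \<open>x\<^sub>a = x\<^sub>b\<close>.  Summands of dimension below \<open>s\<^sub>j\<close> cannot be avoided: for the
  complete graph on two vertices the count is \<open>k\<^sup>2 - 3 k + 3\<close>.  Lattice inside-out polygons of total
  area 1 have no interior lattice point, so their open Ehrhart polynomials vanish at 1, whereas
  \<open>k\<^sup>2 - 3 k + 3\<close> has no real root.  So \<open>of dimension s\<^sub>j\<close> is read as: all dimensions are at most \<open>s\<^sub>j\<close>,
  and \<open>s\<^sub>j\<close> is attained.
\<close>

end

theory Submission
  imports Defs
begin

text \<open>
  Colorings of \<open>G \<times> P\<^sub>2\<close> are pairs of colorings that differ at every vertex.  Automorphisms and color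
  permutations act on such pairs, so the first coloring may be assumed to use exactly the colors
  \<open>1, \<dots>, s\<close>.  Classify a second coloring by its partition into color classes and by its values
  among these \<open>s\<close> colors.  The set of such types does not involve the number \<open>n\<close> of colors, and the
  colorings of a type with \<open>r\<close> classes left are the injections of these classes into the \<open>n - s\<close>
  other colors.  They are the integer points of the open \<open>r\<close>-cube dilated by \<open>n - s + 1\<close>, off the
  hyperplanes \<open>x\<^sub>a = x\<^sub>b\<close>, and are counted by a monic polynomial of degree \<open>r\<close>.  The largest \<open>r\<close> is
  attained by the types that reuse no color of the first coloring.
\<close>

section \<open>The open cube without the braid arrangement\<close>

definition coord_proj :: "'n set \<Rightarrow> real ^ 'n \<Rightarrow> real ^ 'n" where
  "coord_proj I x = (\<chi> i. if i \<in> I then x $ i else 0)"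

definition coord_cube :: "('n :: finite) set \<Rightarrow> (real ^ 'n) set" where
  "coord_cube I = coord_proj I ` cbox 0 1"

definition braid_arrangement :: "('n :: finite) set \<Rightarrow> (real ^ 'n) set set" where
  "braid_arrangement I =
    {{x \<in> range (coord_proj I). (axis a 1 - axis b 1) \<bullet> x = 0} | a b. a \<in> I \<and> b \<in> I \<and> a \<noteq> b}"

lemma coord_proj_nth [simp]: "coord_proj I x $ i = (if i \<in> I then x $ i else 0)"
  by (simp add: coord_proj_def)

lemma linear_coord_proj: "linear (coord_proj I)"
  by (rule linearI) (simp_all add: vec_eq_iff)

lemma range_coord_proj: "range (coord_proj I) = {x. \<forall>i. i \<notin> I \<longrightarrow> x $ i = 0}"
proof -
  have "x = coord_proj I x" if "\<forall>i. i \<notin> I \<longrightarrow> x $ i = 0" for x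
    using that by (simp add: vec_eq_iff)
  then show ?thesis by auto
qed

lemma aff_dim_range_coord_proj: "aff_dim (range (coord_proj I)) = int (card I)"
proof -
  have "subspace (range (coord_proj I))"
    by (intro linear_subspace_image linear_coord_proj subspace_UNIV)
  moreover have "dim (range (coord_proj I)) = card I"
    unfolding range_coord_proj using dim_substandard_cart[where d = I and 'a = real]
    by (simp add: dim_vec_eq)
  ultimately show ?thesis by (simp add: aff_dim_subspace)
qed

lemma interior_unit_cube:
  "interior (cbox (0 :: real ^ 'n) 1) = {x. \<forall>i. 0 < x $ i \<and> x $ i < 1}"
  by (auto simp: interior_cbox mem_box_cart)

lemma interior_unit_cube_nonempty: "interior (cbox (0 :: real ^ 'n) 1) \<noteq> {}"
proof -
  have "(\<chi> i. 1 / 2) \<in> interior (cbox (0 :: real ^ 'n) 1)"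
    unfolding interior_unit_cube by simp
  then show ?thesis by blast
qed

lemma affine_hull_coord_cube: "affine hull (coord_cube I) = range (coord_proj I)"
  unfolding coord_cube_def
  using affine_hull_linear_image[OF linear_conv_bounded_linear[THEN iffD1, OF linear_coord_proj], symmetric]
    affine_hull_nonempty_interior[OF interior_unit_cube_nonempty] by metis

lemma aff_dim_coord_cube: "aff_dim (coord_cube I) = int (card I)"
  using aff_dim_affine_hull[of "coord_cube I"]
  by (simp add: affine_hull_coord_cube aff_dim_range_coord_proj)

lemma rel_interior_coord_cube:
  "rel_interior (coord_cube I) = {x. (\<forall>i\<in>I. 0 < x $ i \<and> x $ i < 1) \<and> (\<forall>i. i \<notin> I \<longrightarrow> x $ i = 0)}"
    (is "_ = ?R")
proof -
  have "rel_interior (coord_cube I) = coord_proj I ` interior (cbox 0 1)"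
    unfolding coord_cube_def
    by (subst rel_interior_convex_linear_image[symmetric])
      (simp_all add: linear_coord_proj rel_interior_nonempty_interior[OF interior_unit_cube_nonempty])
  also have "\<dots> = ?R"
  proof
    show "coord_proj I ` interior (cbox 0 1) \<subseteq> ?R"
      unfolding interior_unit_cube by auto
    show "?R \<subseteq> coord_proj I ` interior (cbox 0 1)"
    proof
      fix x assume x: "x \<in> ?R"
      define y :: "real ^ 'a" where "y = (\<chi> i. if i \<in> I then x $ i else 1 / 2)"
      have "x = coord_proj I y" using x by (auto simp: y_def vec_eq_iff)
      moreover have "y \<in> interior (cbox 0 1)"
        using x unfolding interior_unit_cube by (auto simp: y_def)
      ultimately show "x \<in> coord_proj I ` interior (cbox 0 1)" by blast
    qed
  qed
  finally show ?thesis .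
qed

lemma unit_cube_eq_convex_hull:
  "cbox (0 :: real ^ 'n) 1 = convex hull {x. \<forall>i. x $ i = 0 \<or> x $ i = 1}"
  unfolding Cart_1 unit_interval_convex_hull by (simp add: Basis_vec_def inner_axis)

lemma lattice_polytope_coord_cube: "lattice_polytope (coord_cube I)"
proof -
  let ?S = "{x :: real ^ 'a. \<forall>i. x $ i = 0 \<or> x $ i = 1}"
  have "?S \<subseteq> (\<lambda>J. \<chi> i. if i \<in> J then 1 else 0) ` UNIV"
  proof
    fix x :: "real ^ 'a" assume "x \<in> ?S"
    then have "x = (\<chi> i. if i \<in> {i. x $ i = 1} then 1 else 0)" by (auto simp: vec_eq_iff)
    then show "x \<in> range (\<lambda>J. \<chi> i. if i \<in> J then 1 else 0)" by (rule image_eqI) simp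
  qed
  then have "finite ?S" by (rule finite_subset) simp
  moreover have "0 \<in> ?S" by simp
  then have "?S \<noteq> {}" by blast
  moreover have "coord_proj I ` ?S \<subseteq> integer_points"
  proof -
    have "coord_proj I x $ i \<in> \<int>" if "x \<in> ?S" for x i
    proof -
      from that have "x $ i = 0 \<or> x $ i = 1" by simp
      then show ?thesis by auto
    qed
    then show ?thesis unfolding integer_points_def by blast
  qed
  moreover have "coord_cube I = convex hull (coord_proj I ` ?S)"
    unfolding coord_cube_def unit_cube_eq_convex_hull
    by (rule convex_hull_linear_image[OF linear_coord_proj])
  ultimately show ?thesis unfolding lattice_polytope_def by blast
qed

lemma lattice_inside_out_polytope_coord_cube:
  "lattice_inside_out_polytope (coord_cube I) (braid_arrangement I)"
proof -
  let ?A = "range (coord_proj I)"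
  have "rational_hyperplane_in ?A {x \<in> ?A. (axis a 1 - axis b 1) \<bullet> x = 0}"
    if ab: "a \<in> I" "b \<in> I" "a \<noteq> b" for a b
  proof -
    let ?n = "axis a 1 - axis b 1 :: real ^ 'a"
    have "\<forall>i. ?n $ i \<in> \<rat>" by (simp add: axis_def)
    moreover have "aff_dim (?A \<inter> {x. ?n \<bullet> x = 0}) = aff_dim ?A - 1"
    proof -
      have A: "affine ?A"
        by (intro subspace_imp_affine linear_subspace_image linear_coord_proj subspace_UNIV)
      moreover have "0 \<in> ?A \<inter> {x. ?n \<bullet> x = 0}" by (simp add: range_coord_proj)
      then have "?A \<inter> {x. ?n \<bullet> x = 0} \<noteq> {}" by blast
      moreover have "axis a 1 \<in> ?A" using ab by (auto simp: range_coord_proj axis_def)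
      moreover have "?n \<bullet> axis a 1 \<noteq> 0"
        using ab unfolding inner_axis by (simp add: axis_def)
      ultimately have "\<not> ?A \<subseteq> {x. ?n \<bullet> x = 0}" "?A \<inter> {x. ?n \<bullet> x = 0} \<noteq> {}" by blast+
      then show ?thesis
        unfolding aff_dim_affine_Int_hyperplane[OF A] by (simp only: if_False)
    qed
    moreover have "{x \<in> ?A. ?n \<bullet> x = 0} = ?A \<inter> {x. ?n \<bullet> x = 0}" by blast
    ultimately show ?thesis
      unfolding rational_hyperplane_in_def by (intro conjI exI[of _ ?n] exI[of _ 0]) simp_all
  qed
  moreover have "finite (braid_arrangement I)"
  proof (rule finite_subset)
    show "braid_arrangement I \<subseteq>
      (\<lambda>(a, b). {x \<in> ?A. (axis a 1 - axis b 1) \<bullet> x = 0}) ` UNIV"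
      unfolding braid_arrangement_def by auto
  qed simp
  ultimately show ?thesis
    unfolding lattice_inside_out_polytope_def affine_hull_coord_cube
    using lattice_polytope_coord_cube by (auto simp: braid_arrangement_def)
qed

lemma mem_Union_braid_arrangement:
  "x \<in> \<Union>(braid_arrangement I) \<longleftrightarrow> x \<in> range (coord_proj I) \<and> \<not> inj_on (($) x) I"
proof -
  have "(axis a 1 - axis b 1) \<bullet> x = 0 \<longleftrightarrow> x $ a = x $ b" for a b
    by (simp add: inner_diff_left inner_axis')
  then show ?thesis unfolding braid_arrangement_def inj_on_def by blast
qed

lemma dilated_coord_cube:
  assumes t: "t \<ge> 1"
  shows "(\<lambda>x. real t *\<^sub>R x) ` (rel_interior (coord_cube I) - \<Union>(braid_arrangement I)) =
    {y. (\<forall>i\<in>I. 0 < y $ i \<and> y $ i < real t) \<and> (\<forall>i. i \<notin> I \<longrightarrow> y $ i = 0) \<and> inj_on (($) y) I}"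
    (is "_ ` ?X = ?r")
proof -
  have X: "x \<in> ?X \<longleftrightarrow>
      (\<forall>i\<in>I. 0 < x $ i \<and> x $ i < 1) \<and> (\<forall>i. i \<notin> I \<longrightarrow> x $ i = 0) \<and> inj_on (($) x) I" for x
    unfolding Diff_iff mem_Union_braid_arrangement rel_interior_coord_cube range_coord_proj
      mem_Collect_eq by blast
  have r: "real t *\<^sub>R x \<in> ?r \<longleftrightarrow> x \<in> ?X" for x
  proof -
    have "0 < (real t *\<^sub>R x) $ i \<longleftrightarrow> 0 < x $ i" "(real t *\<^sub>R x) $ i < real t \<longleftrightarrow> x $ i < 1"
      "(real t *\<^sub>R x) $ i = 0 \<longleftrightarrow> x $ i = 0"
      "(real t *\<^sub>R x) $ i = (real t *\<^sub>R x) $ j \<longleftrightarrow> x $ i = x $ j" for i j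
      using t by (simp_all add: zero_less_mult_iff)
    then show ?thesis unfolding X inj_on_def mem_Collect_eq by simp
  qed
  show ?thesis
  proof
    show "(\<lambda>x. real t *\<^sub>R x) ` ?X \<subseteq> ?r" using r by (intro image_subsetI) blast
    show "?r \<subseteq> (\<lambda>x. real t *\<^sub>R x) ` ?X"
    proof
      fix y assume y: "y \<in> ?r"
      define x where "x = (1 / real t) *\<^sub>R y"
      have yx: "y = real t *\<^sub>R x" using t by (simp add: x_def)
      have "x \<in> ?X" using y unfolding yx by (rule iffD1[OF r])
      with yx show "y \<in> (\<lambda>x. real t *\<^sub>R x) ` ?X" by (rule image_eqI)
    qed
  qed
qed

lemma card_inj_PiE:
  assumes "finite A" "finite B"
  shows "card {f \<in> A \<rightarrow>\<^sub>E B. inj_on f A} = (\<Prod>i<card A. card B - i)"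
  using card_inj_on_subset_funcset[OF assms order_refl] by (simp add: lessThan_atLeast0)

lemma of_nat_prod_diff:
  "of_nat (\<Prod>i<r. m - i) = (\<Prod>i<r. of_nat m - of_nat i :: 'a :: comm_ring_1)"
proof (cases "r \<le> m")
  case True
  then show ?thesis by (auto simp: of_nat_diff intro!: prod.cong)
next
  case False
  then have "(\<Prod>i<r. m - i) = 0" by (intro prod_zero) auto
  moreover have "(\<Prod>i<r. of_nat m - of_nat i :: 'a) = 0"
    using False by (intro prod_zero bexI[of _ m]) auto
  ultimately show ?thesis by (simp only: of_nat_0)
qed

lemma open_ehrhart_coord_cube:
  assumes t: "t \<ge> 1"
  shows "open_ehrhart (coord_cube I) (braid_arrangement I) t = (\<Prod>i<card I. (t - 1) - i)"
proof -
  let ?F = "{f \<in> I \<rightarrow>\<^sub>E {1..t - 1}. inj_on f I}"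
  let ?g = "\<lambda>f. \<chi> i. if i \<in> I then real (f i) else 0"
  let ?L = "integer_points \<inter>
    (\<lambda>x. real t *\<^sub>R x) ` (rel_interior (coord_cube I) - \<Union>(braid_arrangement I))"
  have "inj_on ?g ?F"
  proof (rule inj_onI)
    fix f h assume fh: "f \<in> ?F" "h \<in> ?F" "?g f = ?g h"
    have "f i = h i" if "i \<in> I" for i
    proof -
      have "?g f $ i = ?g h $ i" by (simp only: fh(3))
      then show ?thesis using that by simp
    qed
    moreover have "f \<in> I \<rightarrow>\<^sub>E {1..t - 1}" "h \<in> I \<rightarrow>\<^sub>E {1..t - 1}" using fh(1,2) by simp_all
    ultimately show "f = h" by (intro PiE_ext)
  qed
  moreover have "?g ` ?F = ?L"
  proof
    show "?g ` ?F \<subseteq> ?L"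
    proof
      fix y assume "y \<in> ?g ` ?F"
      then obtain f where f: "f \<in> I \<rightarrow>\<^sub>E {1..t - 1}" "inj_on f I" and y: "y = ?g f" by blast
      have "1 \<le> f i \<and> f i < t" if "i \<in> I" for i
        using PiE_mem[OF f(1) that] t by auto
      then have "\<forall>i\<in>I. 0 < y $ i \<and> y $ i < real t" "\<forall>i. i \<notin> I \<longrightarrow> y $ i = 0"
        unfolding y by (simp_all add: Suc_le_eq)
      moreover have "inj_on (($) y) I"
        using f(2) unfolding y by (simp add: inj_on_def)
      moreover have "y \<in> integer_points" unfolding y integer_points_def by simp
      ultimately show "y \<in> ?L" unfolding dilated_coord_cube[OF t] by simp
    qed
    show "?L \<subseteq> ?g ` ?F"
    proof
      fix y assume "y \<in> ?L"
      then have y_int: "y \<in> integer_points"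
        and y_in: "\<forall>i\<in>I. 0 < y $ i \<and> y $ i < real t"
        and y_out: "\<forall>i. i \<notin> I \<longrightarrow> y $ i = 0"
        and y_inj: "inj_on (($) y) I"
        unfolding dilated_coord_cube[OF t] by simp_all
      define f where "f = (\<lambda>i\<in>I. nat \<lfloor>y $ i\<rfloor>)"
      have y': "0 < y $ i" "y $ i < real t" if "i \<in> I" for i
        using y_in that by simp_all
      have f: "real (f i) = y $ i" if "i \<in> I" for i
      proof -
        obtain z where "y $ i = of_int z" using y_int unfolding integer_points_def by (auto elim: Ints_cases)
        then show ?thesis using y'(1)[OF that] that by (simp add: f_def)
      qed
      have "f i \<in> {1..t - 1}" if "i \<in> I" for i
      proof -
        have "0 < f i" "f i < t" using y'[OF that] f[OF that] by linarith+
        then show ?thesis by simp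
      qed
      moreover have "inj_on f I"
      proof (rule inj_onI)
        fix a b assume ab: "a \<in> I" "b \<in> I" "f a = f b"
        then have "y $ a = y $ b" using f[of a] f[of b] by simp
        then show "a = b" using inj_onD[OF y_inj] ab by blast
      qed
      moreover have "f \<in> extensional I" by (simp add: f_def)
      ultimately have "f \<in> ?F" by (simp add: PiE_def)
      moreover have "y = ?g f"
        unfolding vec_eq_iff using y_out f by simp
      ultimately show "y \<in> ?g ` ?F" by blast
    qed
  qed
  ultimately have "card ?L = card ?F" using card_image[of ?g ?F] by simp
  also have "\<dots> = (\<Prod>i<card I. (t - 1) - i)" by (subst card_inj_PiE) simp_all
  finally show ?thesis by (simp add: open_ehrhart_def)
qed

definition ff_poly :: "nat \<Rightarrow> real poly" where
  "ff_poly r = (\<Prod>i<r. [:- 1 - real i, 1:])"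

lemma poly_ff_poly: "t \<ge> 1 \<Longrightarrow> poly (ff_poly r) (real t) = real (\<Prod>i<r. (t - 1) - i)"
  unfolding of_nat_prod_diff by (simp add: ff_poly_def poly_prod of_nat_diff algebra_simps)

lemma degree_ff_poly: "degree (ff_poly r) = r"
  unfolding ff_poly_def by (subst degree_prod_eq_sum_degree) auto

lemma lead_coeff_ff_poly: "lead_coeff (ff_poly r) = 1"
  unfolding ff_poly_def by (subst lead_coeff_prod) simp

lemma open_ehrhart_polynomial_coord_cube:
  "open_ehrhart_polynomial (coord_cube I) (braid_arrangement I) (ff_poly (card I))"
  unfolding open_ehrhart_polynomial_def by (simp add: poly_ff_poly open_ehrhart_coord_cube)

section \<open>Counting pairs of colorings\<close>

lemma bij_betw_prism_colorings:
  fixes G :: "'v pair_pre_digraph"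
  assumes G: "pair_graph G"
  shows "bij_betw (\<lambda>f. (restrict_copy G 1 f, restrict_copy G 2 f))
    (proper_colorings (cartesian_prod G P2) n)
    {(c, d) \<in> proper_colorings G n \<times> proper_colorings G n. \<forall>v \<in> pverts G. d v \<noteq> c v}"
    (is "bij_betw ?r ?A ?B")
proof -
  interpret pair_graph G by fact
  have V: "pverts (cartesian_prod G P2) = pverts G \<times> {1, 2}"
    by (simp add: cartesian_prod_def P2_def)
  have E: "((u, a), (v, b)) \<in> parcs (cartesian_prod G P2) \<longleftrightarrow>
      (u = v \<and> u \<in> pverts G \<and> (a = 1 \<and> b = 2 \<or> a = 2 \<and> b = 1)) \<or>
      (a = b \<and> (a = 1 \<or> a = 2) \<and> (u, v) \<in> parcs G)" for u v a b
    by (auto simp: cartesian_prod_def P2_def)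
  define g :: "('v \<Rightarrow> nat) \<times> ('v \<Rightarrow> nat) \<Rightarrow> 'v \<times> nat \<Rightarrow> nat" where
    "g = (\<lambda>(c, d). \<lambda>(v, a) \<in> pverts G \<times> {1, 2}. if a = 1 then c v else d v)"
  show ?thesis
  proof (rule bij_betwI[where g = g])
    show "?r \<in> ?A \<rightarrow> ?B"
    proof
      fix f assume "f \<in> ?A"
      then have f: "f p \<in> {1..n}" if "p \<in> pverts G \<times> {1, 2}" for p
        using that unfolding mem_proper_colorings V by blast
      have f': "f (u, a) \<noteq> f (v, b)" if "((u, a), (v, b)) \<in> parcs (cartesian_prod G P2)" for u v a b
        using \<open>f \<in> ?A\<close> that unfolding mem_proper_colorings by blast
      have "restrict_copy G a f \<in> proper_colorings G n" if "a = 1 \<or> a = 2" for a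
        unfolding mem_proper_colorings
        using that f[of "(_, a)"] f'[of _ a _ a]
        by (auto simp: restrict_copy_def E dest: in_arcsD1 in_arcsD2)
      then show "?r f \<in> ?B"
        using f'[of _ 2 _ 1] by (auto simp: restrict_copy_def E)
    qed
    show "g \<in> ?B \<rightarrow> ?A"
    proof
      fix p assume "p \<in> ?B"
      then obtain c d where p: "p = (c, d)" and c: "c \<in> proper_colorings G n"
        and d: "d \<in> proper_colorings G n" and cd: "\<forall>v \<in> pverts G. d v \<noteq> c v" by blast
      have *: "g p (u, a) \<noteq> g p (v, b)"
        if "((u, a), (v, b)) \<in> parcs (cartesian_prod G P2)" for u a v b
        using that c d cd in_arcsD1[of u v] in_arcsD2[of u v]
        unfolding E mem_proper_colorings p g_def
        by (elim disjE conjE) (auto, (metis+)?)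
      have **: "g p (u, a) \<in> {1..n}" if "(u, a) \<in> pverts G \<times> {1, 2}" for u a
        using that c d unfolding mem_proper_colorings p g_def by (auto split: if_splits)
      have "g p x = undefined" if "x \<notin> pverts G \<times> {1, 2}" for x
        using that unfolding p g_def by auto
      with * ** show "g p \<in> ?A" unfolding mem_proper_colorings V by (metis surj_pair)
    qed
    show "g (?r f) = f" if "f \<in> ?A" for f
    proof
      fix x
      show "g (?r f) x = f x"
        using that unfolding mem_proper_colorings V g_def restrict_copy_def
        by (cases x) auto
    qed
    show "?r (g p) = p" if "p \<in> ?B" for p
      using that unfolding g_def restrict_copy_def
      by (auto simp: mem_proper_colorings fun_eq_iff)
  qed
qed

lemma card_Collect_bij_betw:
  assumes "bij_betw f A B"
  shows "card {x \<in> A. P (f x)} = card {y \<in> B. P y}"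
proof -
  have "f ` {x \<in> A. P (f x)} = {y \<in> B. P y}" using assms by (auto simp: bij_betw_def)
  moreover have "inj_on f {x \<in> A. P (f x)}"
    using assms by (auto simp: bij_betw_def inj_on_def)
  ultimately show ?thesis by (metis card_image)
qed

lemma L_count_eq:
  assumes "pair_graph G" "c \<in> proper_colorings G n" "Y \<subseteq> proper_colorings G n"
  shows "L_count G n c Y = card {d \<in> Y. \<forall>v \<in> pverts G. d v \<noteq> c v}"
proof -
  have "L_count G n c Y = card {p \<in> {(c, d) \<in> proper_colorings G n \<times> proper_colorings G n.
      \<forall>v \<in> pverts G. d v \<noteq> c v}. fst p = c \<and> snd p \<in> Y}"
    unfolding L_count_def card_Collect_bij_betw[OF bij_betw_prism_colorings[OF assms(1)], symmetric]
    by simp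
  also have "\<dots> = card (Pair c ` {d \<in> Y. \<forall>v \<in> pverts G. d v \<noteq> c v})"
    using assms(2,3) by (intro arg_cong[where f = card]) auto
  also have "\<dots> = card {d \<in> Y. \<forall>v \<in> pverts G. d v \<noteq> c v}"
    by (rule card_image) (simp add: inj_on_def)
  finally show ?thesis .
qed

lemma finite_proper_colorings: "finite (pverts G) \<Longrightarrow> finite (proper_colorings G n)"
  unfolding proper_colorings_def
  by (rule finite_subset[of _ "pverts G \<rightarrow>\<^sub>E {1..n}"]) (auto intro!: finite_PiE)

lemma chi_count_eq_sum:
  assumes "pair_graph G" "X \<subseteq> proper_colorings G n" "Y \<subseteq> proper_colorings G n"
  shows "chi_count G n X Y = (\<Sum>c\<in>X. L_count G n c Y)"
proof -
  interpret pair_graph G by fact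
  have fin: "finite X" "finite Y"
    using assms(2,3) finite_proper_colorings[OF pair_finite_verts] finite_subset by blast+
  have "chi_count G n X Y = card {p \<in> {(c, d) \<in> proper_colorings G n \<times> proper_colorings G n.
      \<forall>v \<in> pverts G. d v \<noteq> c v}. fst p \<in> X \<and> snd p \<in> Y}"
    unfolding chi_count_def card_Collect_bij_betw[OF bij_betw_prism_colorings[OF assms(1)], symmetric]
    by simp
  also have "\<dots> = card (SIGMA c:X. {d \<in> Y. \<forall>v \<in> pverts G. d v \<noteq> c v})"
    using assms(2,3) by (intro arg_cong[where f = card]) auto
  also have "\<dots> = (\<Sum>c\<in>X. card {d \<in> Y. \<forall>v \<in> pverts G. d v \<noteq> c v})"
    using fin by simp
  also have "\<dots> = (\<Sum>c\<in>X. L_count G n c Y)"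
    using assms by (intro sum.cong refl) (auto simp: L_count_eq)
  finally show ?thesis .
qed

lemma color_action_proper:
  assumes "pair_graph G" "c \<in> proper_colorings G n" "\<pi> permutes {1..n}"
  shows "color_action G \<pi> c \<in> proper_colorings G n"
    and "color_classes G (color_action G \<pi> c) = color_classes G c"
proof -
  have "color_action G \<pi> c \<in> orbit (sym_group n) (color_action G) c"
    using assms(3) by (auto simp: orbit_def sym_group_def)
  then show "color_action G \<pi> c \<in> proper_colorings G n"
    and "color_classes G (color_action G \<pi> c) = color_classes G c"
    unfolding color_orbit_eq[OF assms(1,2)] by auto
qed

lemma inv_in_subgroup:
  assumes S: "subgroup \<G> (aut_group G)" and \<sigma>: "\<sigma> \<in> \<G>"
  shows "inv_into UNIV \<sigma> \<in> \<G>"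
proof -
  let ?i = "inv_into UNIV \<sigma>"
  have c: "\<sigma> \<in> carrier (aut_group G)" using subgroup.subset[OF S] \<sigma> by blast
  then have p: "\<sigma> permutes pverts G" by (auto simp: aut_group_def)
  have "(?i u, ?i v) \<in> parcs G \<longleftrightarrow> (u, v) \<in> parcs G" if "u \<in> pverts G" "v \<in> pverts G" for u v
  proof -
    have "?i u \<in> pverts G" "?i v \<in> pverts G"
      using that permutes_in_image[OF permutes_inv[OF p]] by auto
    then have "(\<sigma> (?i u), \<sigma> (?i v)) \<in> parcs G \<longleftrightarrow> (?i u, ?i v) \<in> parcs G"
      using c by (auto simp: aut_group_def)
    then show ?thesis by (simp add: permutes_inverses(1)[OF p])
  qed
  then have i: "?i \<in> carrier (aut_group G)"
    using permutes_inv[OF p] by (simp add: aut_group_def)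
  have "m_inv (aut_group G) \<sigma> = ?i"
    unfolding m_inv_def
  proof (rule the_equality)
    show "?i \<in> carrier (aut_group G) \<and> \<sigma> \<otimes>\<^bsub>aut_group G\<^esub> ?i = \<one>\<^bsub>aut_group G\<^esub> \<and>
        ?i \<otimes>\<^bsub>aut_group G\<^esub> \<sigma> = \<one>\<^bsub>aut_group G\<^esub>"
      using i permutes_inv_o[OF p] by (simp add: aut_group_def)
    show "y = ?i" if "y \<in> carrier (aut_group G) \<and> \<sigma> \<otimes>\<^bsub>aut_group G\<^esub> y = \<one>\<^bsub>aut_group G\<^esub> \<and>
        y \<otimes>\<^bsub>aut_group G\<^esub> \<sigma> = \<one>\<^bsub>aut_group G\<^esub>" for y
      using that by (intro inv_unique_comp[symmetric]) (simp_all add: aut_group_def)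
  qed
  then show ?thesis using subgroup.m_inv_closed[OF S \<sigma>] by simp
qed

lemma L_count_le:
  assumes G: "pair_graph G" and \<sigma>: "\<sigma> \<in> carrier (aut_group G)"
    and c: "c \<in> proper_colorings G n" and c': "c' \<in> proper_colorings G n"
    and eq: "color_classes G c' = image \<sigma> ` color_classes G c"
    and Q: "\<And>Z. Z \<in> Q \<Longrightarrow> image \<sigma> ` Z \<in> Q"
  shows "L_count G n c {d \<in> proper_colorings G n. color_classes G d \<in> Q} \<le>
    L_count G n c' {d \<in> proper_colorings G n. color_classes G d \<in> Q}"
proof -
  interpret pair_graph G by fact
  let ?Y = "{d \<in> proper_colorings G n. color_classes G d \<in> Q}"
  have p: "\<sigma> permutes pverts G" using \<sigma> by (auto simp: aut_group_def)
  note cv = color_classes_vertex_action[OF p]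
  have va: "vertex_action \<sigma> d \<in> proper_colorings G n" if "d \<in> proper_colorings G n" for d
    using vertex_action_proper[OF \<sigma> that G] .
  have "color_classes G (vertex_action \<sigma> c) = color_classes G c'" by (simp add: cv eq)
  moreover have "vertex_action \<sigma> c ` pverts G \<subseteq> {1..n}" "c' ` pverts G \<subseteq> {1..n}"
    using va[OF c] c' unfolding mem_proper_colorings by blast+
  ultimately obtain \<pi> where \<pi>: "\<pi> permutes {1..n}"
    and c'_eq: "\<forall>v \<in> pverts G. c' v = \<pi> (vertex_action \<sigma> c v)"
    using recolor[OF pair_finite_verts, of "vertex_action \<sigma> c" n c'] by blast
  let ?g = "\<lambda>d. color_action G \<pi> (vertex_action \<sigma> d)"
  have im: "inv_into UNIV \<sigma> v \<in> pverts G \<longleftrightarrow> v \<in> pverts G" for v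
    using permutes_in_image[OF permutes_inv[OF p]] by auto
  have "card {d \<in> ?Y. \<forall>v \<in> pverts G. d v \<noteq> c v} \<le> card {d \<in> ?Y. \<forall>v \<in> pverts G. d v \<noteq> c' v}"
  proof (rule card_inj_on_le[where f = ?g])
    show "inj_on ?g {d \<in> ?Y. \<forall>v \<in> pverts G. d v \<noteq> c v}"
    proof (rule inj_onI)
      fix d e assume d: "d \<in> {d \<in> ?Y. \<forall>v \<in> pverts G. d v \<noteq> c v}"
        and e: "e \<in> {d \<in> ?Y. \<forall>v \<in> pverts G. d v \<noteq> c v}" and de: "?g d = ?g e"
      have "d v = e v" if "v \<in> pverts G" for v
      proof -
        have "\<sigma> v \<in> pverts G" using permutes_in_image[OF p] that by blast
        then have "\<pi> (d v) = \<pi> (e v)"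
          using fun_cong[OF de, of "\<sigma> v"] permutes_inverses(2)[OF p, of v]
          by (simp add: color_action_def vertex_action_def)
        then show ?thesis using permutes_inj[OF \<pi>] by (simp add: inj_eq)
      qed
      moreover have "d v = e v" if "v \<notin> pverts G" for v
        using d e that by (simp add: mem_proper_colorings)
      ultimately show "d = e" by blast
    qed
    show "?g ` {d \<in> ?Y. \<forall>v \<in> pverts G. d v \<noteq> c v} \<subseteq> {d \<in> ?Y. \<forall>v \<in> pverts G. d v \<noteq> c' v}"
    proof (rule image_subsetI)
      fix d assume d: "d \<in> {d \<in> ?Y. \<forall>v \<in> pverts G. d v \<noteq> c v}"
      then have "?g d \<in> ?Y"
        using color_action_proper[OF G va \<pi>, of d] Q by (auto simp: cv)
      moreover have "?g d v \<noteq> c' v" if "v \<in> pverts G" for v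
        using d that c'_eq im[of v] permutes_inj[OF \<pi>]
        by (auto simp: color_action_def vertex_action_def inj_eq)
      ultimately show "?g d \<in> {d \<in> ?Y. \<forall>v \<in> pverts G. d v \<noteq> c' v}" by blast
    qed
    show "finite {d \<in> ?Y. \<forall>v \<in> pverts G. d v \<noteq> c' v}"
      using finite_proper_colorings[OF pair_finite_verts, of n] by simp
  qed
  then show ?thesis using c c' by (simp add: L_count_eq[OF G])
qed

lemma L_count_cong:
  assumes G: "pair_graph G" and S: "subgroup \<G> (aut_group G)" and \<sigma>: "\<sigma> \<in> \<G>"
    and c: "c \<in> proper_colorings G n" and c': "c' \<in> proper_colorings G n"
    and eq: "color_classes G c' = image \<sigma> ` color_classes G c"
    and Q: "\<And>Z \<tau>. Z \<in> Q \<Longrightarrow> \<tau> \<in> \<G> \<Longrightarrow> image \<tau> ` Z \<in> Q"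
  shows "L_count G n c {d \<in> proper_colorings G n. color_classes G d \<in> Q} =
    L_count G n c' {d \<in> proper_colorings G n. color_classes G d \<in> Q}"
proof (rule antisym)
  have sub: "\<G> \<subseteq> carrier (aut_group G)" using S by (rule subgroup.subset)
  show "L_count G n c {d \<in> proper_colorings G n. color_classes G d \<in> Q} \<le>
      L_count G n c' {d \<in> proper_colorings G n. color_classes G d \<in> Q}"
    by (rule L_count_le[OF G _ c c' eq]) (use sub \<sigma> Q in auto)
  define \<tau> where "\<tau> = inv_into UNIV \<sigma>"
  have \<tau>: "\<tau> \<in> \<G>" "\<tau> \<circ> \<sigma> = id"
    using inv_in_subgroup[OF S \<sigma>] permutes_inv_o(2) sub \<sigma> unfolding \<tau>_def aut_group_def by auto
  have "image \<tau> ` color_classes G c' = image (\<tau> \<circ> \<sigma>) ` color_classes G c"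
    by (simp add: eq image_image image_comp)
  then have "color_classes G c = image \<tau> ` color_classes G c'" by (simp add: \<tau>(2))
  then show "L_count G n c' {d \<in> proper_colorings G n. color_classes G d \<in> Q} \<le>
      L_count G n c {d \<in> proper_colorings G n. color_classes G d \<in> Q}"
    using sub \<tau> Q by (intro L_count_le[OF G _ c' c]) auto
qed

section \<open>Types of second colorings\<close>

text \<open>Since colors are positive, the value \<open>0\<close> is free to mark the vertices with a color above \<open>s\<close>.\<close>

definition low_part :: "'v set \<Rightarrow> nat \<Rightarrow> ('v \<Rightarrow> nat) \<Rightarrow> 'v \<Rightarrow> nat" where
  "low_part V s d = (\<lambda>v \<in> V. if d v \<le> s then d v else 0)"

definition compatible :: "'v set \<Rightarrow> ('v \<Rightarrow> nat) \<Rightarrow> ('v \<Rightarrow> nat) \<Rightarrow> bool" where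
  "compatible V d e \<longleftrightarrow> (\<forall>u \<in> V. \<forall>v \<in> V. e u \<noteq> 0 \<longrightarrow> (e u = e v \<longleftrightarrow> d u = d v))"

lemma card_colorings_of_type:
  assumes G: "pair_graph G" and d0: "d0 \<in> proper_colorings G k"
    and e: "e \<in> pverts G \<rightarrow>\<^sub>E {0..s}" "compatible (pverts G) d0 e" and n: "s \<le> n"
  shows "card {d \<in> proper_colorings G n.
      color_classes G d = color_classes G d0 \<and> low_part (pverts G) s d = e} =
    (\<Prod>i<card (d0 ` {v \<in> pverts G. e v = 0}). (n - s) - i)"
proof -
  interpret pair_graph G by fact
  let ?V = "pverts G"
  let ?Z = "{v \<in> ?V. e v = 0}"
  let ?F = "{f \<in> d0 ` ?Z \<rightarrow>\<^sub>E {s+1..n}. inj_on f (d0 ` ?Z)}"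
  let ?D = "{d \<in> proper_colorings G n. color_classes G d = color_classes G d0 \<and> low_part ?V s d = e}"
  define g where "g f = (\<lambda>v \<in> ?V. if e v = 0 then f (d0 v) else e v)" for f
  have g: "g f v = (if e v = 0 then f (d0 v) else e v)" if "v \<in> ?V" for f v
    using that by (simp add: g_def)
  have e_le: "e v \<le> s" if "v \<in> ?V" for v using PiE_mem[OF e(1) that] by simp
  have f_in: "s < f (d0 v) \<and> f (d0 v) \<le> n" if "f \<in> ?F" "v \<in> ?Z" for f v
  proof -
    have "f \<in> d0 ` ?Z \<rightarrow>\<^sub>E {s+1..n}" using that(1) by simp
    moreover have "d0 v \<in> d0 ` ?Z" using that(2) by (rule imageI)
    ultimately have "f (d0 v) \<in> {s+1..n}" by (rule PiE_mem)
    then show ?thesis by simp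
  qed
  have "g ` ?F = ?D"
  proof
    show "g ` ?F \<subseteq> ?D"
    proof (rule image_subsetI)
      fix f assume f: "f \<in> ?F"
      have eq: "g f u = g f v \<longleftrightarrow> d0 u = d0 v" if uv: "u \<in> ?V" "v \<in> ?V" for u v
      proof (cases "e u = 0 \<and> e v = 0")
        case True
        then have "d0 u \<in> d0 ` ?Z" "d0 v \<in> d0 ` ?Z" using uv by auto
        moreover have "inj_on f (d0 ` ?Z)" using f by simp
        ultimately show ?thesis using True uv by (simp add: g inj_on_eq_iff)
      next
        case False
        then have "e u = e v \<longleftrightarrow> d0 u = d0 v"
          using e(2) uv unfolding compatible_def by metis
        then show ?thesis
          using False uv f_in[OF f, of u] f_in[OF f, of v] e_le[of u] e_le[of v] by (auto simp: g)
      qed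
      have im: "g f ` ?V \<subseteq> {1..n}"
      proof (rule image_subsetI)
        fix v assume "v \<in> ?V"
        then show "g f v \<in> {1..n}" using f_in[OF f, of v] e_le[of v] n by (auto simp: g)
      qed
      have "g f \<in> extensional ?V" by (simp add: g_def)
      then have "g f \<in> proper_colorings G n"
        by (rule mem_proper_coloringsI[OF _ im d0 G]) (simp add: eq)
      moreover have "color_classes G (g f) = color_classes G d0"
        unfolding color_classes_eq_iff using eq by blast
      moreover have "low_part ?V s (g f) = e"
      proof
        fix v
        show "low_part ?V s (g f) v = e v"
          using e_le[of v] f_in[OF f, of v] PiE_arb[OF e(1), of v]
          by (cases "v \<in> ?V"; cases "e v = 0") (auto simp: low_part_def g)
      qed
      ultimately show "g f \<in> ?D" by blast
    qed
    show "?D \<subseteq> g ` ?F"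
    proof
      fix d assume d: "d \<in> ?D"
      then have ed: "e v = (if d v \<le> s then d v else 0)" if "v \<in> ?V" for v
        using that by (auto simp: low_part_def)
      have eq: "d u = d v \<longleftrightarrow> d0 u = d0 v" if "u \<in> ?V" "v \<in> ?V" for u v
        using d that by (simp add: color_classes_eq_iff)
      have d_in: "1 \<le> d v" "d v \<le> n" if "v \<in> ?V" for v
        using d that by (auto simp: mem_proper_colorings)
      define f where "f = (\<lambda>i \<in> d0 ` ?Z. d (SOME v. v \<in> ?Z \<and> d0 v = i))"
      have f: "f (d0 v) = d v" if v: "v \<in> ?Z" for v
      proof -
        have "(SOME w. w \<in> ?Z \<and> d0 w = d0 v) \<in> ?Z \<and> d0 (SOME w. w \<in> ?Z \<and> d0 w = d0 v) = d0 v"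
          by (rule someI[of _ v]) (use v in auto)
        then have "d (SOME w. w \<in> ?Z \<and> d0 w = d0 v) = d v" using eq v by blast
        then show ?thesis using v by (simp add: f_def)
      qed
      have "f i \<in> {s+1..n}" if "i \<in> d0 ` ?Z" for i
      proof -
        from that obtain v where v: "v \<in> ?Z" "i = d0 v" by blast
        then show ?thesis using ed[of v] d_in[of v] f[OF v(1)] by (auto split: if_splits)
      qed
      moreover have "inj_on f (d0 ` ?Z)"
      proof (rule inj_onI)
        fix i j assume "i \<in> d0 ` ?Z" "j \<in> d0 ` ?Z" and fij: "f i = f j"
        then obtain u v where "u \<in> ?Z" "i = d0 u" "v \<in> ?Z" "j = d0 v" by blast
        with fij show "i = j" using f eq by simp
      qed
      moreover have "f \<in> extensional (d0 ` ?Z)" by (simp add: f_def)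
      ultimately have "f \<in> ?F" by (simp add: PiE_def)
      moreover have "d = g f"
      proof
        fix v
        show "d v = g f v"
          using d f[of v] ed[of v] d_in[of v]
          by (cases "v \<in> ?V") (simp_all add: g_def mem_proper_colorings split: if_splits)
      qed
      ultimately show "d \<in> g ` ?F" by blast
    qed
  qed
  moreover have "inj_on g ?F"
  proof (rule inj_onI)
    fix f h assume fh: "f \<in> ?F" "h \<in> ?F" "g f = g h"
    have "f i = h i" if "i \<in> d0 ` ?Z" for i
    proof -
      from that obtain v where v: "v \<in> ?Z" "i = d0 v" by blast
      then show ?thesis using fun_cong[OF fh(3), of v] by (simp add: g)
    qed
    moreover have "f \<in> d0 ` ?Z \<rightarrow>\<^sub>E {s+1..n}" "h \<in> d0 ` ?Z \<rightarrow>\<^sub>E {s+1..n}" using fh(1,2) by simp_all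
    ultimately show "f = h" by (intro PiE_ext)
  qed
  ultimately have "card ?D = card ?F" using card_image[of g ?F] by simp
  also have "\<dots> = (\<Prod>i<card (d0 ` ?Z). (n - s) - i)"
    by (subst card_inj_PiE) auto
  finally show ?thesis .
qed

definition second_types :: "'v pair_pre_digraph \<Rightarrow> nat \<Rightarrow> ('v \<Rightarrow> nat) \<Rightarrow> ('v \<Rightarrow> nat) set \<Rightarrow>
    (('v \<Rightarrow> nat) \<times> ('v \<Rightarrow> nat)) set" where
  "second_types G s c R = {(d0, e) \<in> R \<times> (pverts G \<rightarrow>\<^sub>E {0..s}).
    compatible (pverts G) d0 e \<and> (\<forall>v \<in> pverts G. e v \<noteq> c v)}"

lemma finite_second_types:
  assumes "finite (pverts G)" "finite R"
  shows "finite (second_types G s c R)"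
proof (rule finite_subset)
  show "second_types G s c R \<subseteq> R \<times> (pverts G \<rightarrow>\<^sub>E {0..s})"
    unfolding second_types_def by blast
  show "finite (R \<times> (pverts G \<rightarrow>\<^sub>E {0..s}))"
    using assms by (intro finite_cartesian_product finite_PiE) simp_all
qed

text \<open>
  Here \<open>R\<close> is a transversal of the partitions in question; neither it nor \<open>second_types\<close> depends on
  the number \<open>n\<close> of colors.
\<close>

lemma L_count_eq_sum_types:
  assumes G: "pair_graph G" and c: "c \<in> proper_colorings G n" and cs: "c ` pverts G \<subseteq> {1..s}"
    and n: "s \<le> n" and R: "R \<subseteq> proper_colorings G k" "inj_on (color_classes G) R"
  shows "L_count G n c {d \<in> proper_colorings G n. color_classes G d \<in> color_classes G ` R} =
    (\<Sum>(d0, e)\<in>second_types G s c R. \<Prod>i<card (d0 ` {v \<in> pverts G. e v = 0}). (n - s) - i)"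
proof -
  interpret pair_graph G by fact
  let ?V = "pverts G"
  let ?cc = "color_classes G"
  let ?T = "second_types G s c R"
  let ?D = "{d \<in> {d \<in> proper_colorings G n. color_classes G d \<in> color_classes G ` R}.
    \<forall>v \<in> ?V. d v \<noteq> c v}"
  define \<rho> where "\<rho> d = (inv_into R (color_classes G) (color_classes G d), low_part ?V s d)" for d
  have finR: "finite R"
    using R(1) finite_proper_colorings[OF pair_finite_verts] finite_subset by blast
  have finT: "finite ?T"
    using pair_finite_verts finR by (rule finite_second_types)
  have finD: "finite ?D" using finite_proper_colorings[OF pair_finite_verts, of n] by simp
  have cv: "1 \<le> c v" "c v \<le> s" if "v \<in> ?V" for v using cs that by auto
  have "\<rho> ` ?D \<subseteq> ?T"
  proof (rule image_subsetI)
    fix d assume d: "d \<in> ?D"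
    let ?d0 = "inv_into R (color_classes G) (color_classes G d)"
    from d have dR: "?cc d \<in> ?cc ` R" by blast
    have "?d0 \<in> R" "?cc ?d0 = ?cc d"
      using inv_into_into[OF dR] f_inv_into_f[OF dR] by simp_all
    moreover from this(2) have "compatible ?V ?d0 (low_part ?V s d)"
      unfolding color_classes_eq_iff compatible_def low_part_def by (auto split: if_splits)
    moreover have "low_part ?V s d v \<noteq> c v" if "v \<in> ?V" for v
      using d that cv[OF that] by (auto simp: low_part_def)
    moreover have "low_part ?V s d \<in> ?V \<rightarrow>\<^sub>E {0..s}" by (auto simp: low_part_def)
    ultimately show "\<rho> d \<in> ?T" by (auto simp: \<rho>_def second_types_def)
  qed
  then have "card ?D = (\<Sum>t\<in>?T. card {d \<in> ?D. \<rho> d = t})"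
    using sum.group[OF finD finT, of \<rho> "\<lambda>_. 1 :: nat"] by simp
  also have "\<dots> = (\<Sum>(d0, e)\<in>?T. \<Prod>i<card (d0 ` {v \<in> ?V. e v = 0}). (n - s) - i)"
  proof (rule sum.cong[OF refl])
    fix t assume t: "t \<in> ?T"
    obtain d0 e where [simp]: "t = (d0, e)" by (cases t)
    have d0: "d0 \<in> R" and e: "e \<in> ?V \<rightarrow>\<^sub>E {0..s}" "compatible ?V d0 e" "\<forall>v \<in> ?V. e v \<noteq> c v"
      using t by (auto simp: second_types_def)
    have "{d \<in> ?D. \<rho> d = t} =
      {d \<in> proper_colorings G n. color_classes G d = color_classes G d0 \<and> low_part ?V s d = e}"
      (is "?l = ?r")
    proof
      show "?l \<subseteq> ?r"
      proof
        fix d assume d: "d \<in> ?l"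
        then have "?cc d \<in> ?cc ` R" by blast
        then have "?cc (inv_into R ?cc (?cc d)) = ?cc d" by (rule f_inv_into_f)
        with d show "d \<in> ?r" by (simp add: \<rho>_def)
      qed
      show "?r \<subseteq> ?l"
      proof
        fix d assume d: "d \<in> ?r"
        have "d v \<noteq> c v" if "v \<in> ?V" for v
        proof
          assume "d v = c v"
          moreover have "e v = (if d v \<le> s then d v else 0)" using d that by (auto simp: low_part_def)
          ultimately show False using e(3) cv[OF that] that by auto
        qed
        with d d0 R(2) show "d \<in> ?l" by (auto simp: \<rho>_def)
      qed
    qed
    then show "card {d \<in> ?D. \<rho> d = t} =
        (case t of (d0, e) \<Rightarrow> \<Prod>i<card (d0 ` {v \<in> ?V. e v = 0}). (n - s) - i)"
      using card_colorings_of_type[OF G _ e(1,2) n] d0 R(1) by auto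
  qed
  finally show ?thesis using c by (subst L_count_eq[OF G]) auto
qed

lemma low_coloring_exists:
  assumes "pair_graph G" "c0 \<in> proper_colorings G k"
  obtains c where "color_classes G c = color_classes G c0"
    "c ` pverts G \<subseteq> {1..card (c0 ` pverts G)}"
    "\<And>n. card (c0 ` pverts G) \<le> n \<Longrightarrow> c \<in> proper_colorings G n"
proof -
  interpret pair_graph G by fact
  let ?s = "card (c0 ` pverts G)"
  have "card (c0 ` pverts G) = card {1..?s}" by simp
  then obtain h where h: "bij_betw h (c0 ` pverts G) {1..?s}"
    using finite_same_card_bij[of "c0 ` pverts G" "{1..?s}"] pair_finite_verts by auto
  define c where "c = (\<lambda>v \<in> pverts G. h (c0 v))"
  have eq: "c u = c v \<longleftrightarrow> c0 u = c0 v" if "u \<in> pverts G" "v \<in> pverts G" for u v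
    using that h by (auto simp: c_def bij_betw_def inj_on_def)
  have im: "c ` pverts G \<subseteq> {1..?s}"
    using bij_betwE[OF h] by (auto simp: c_def)
  show ?thesis
  proof
    show "color_classes G c = color_classes G c0" using eq by (simp add: color_classes_eq_iff)
    show "c \<in> proper_colorings G n" if "?s \<le> n" for n
    proof (rule mem_proper_coloringsI[OF _ _ assms(2,1)])
      show "c \<in> extensional (pverts G)" by (simp add: c_def)
      show "c ` pverts G \<subseteq> {1..n}" using im that by fastforce
    qed (simp add: eq)
  qed (rule im)
qed

lemma degree_sum_monic:
  fixes q :: "'a \<Rightarrow> real poly"
  assumes T: "finite T" and q: "\<And>t. t \<in> T \<Longrightarrow> lead_coeff (q t) = 1"
    and le: "\<And>t. t \<in> T \<Longrightarrow> degree (q t) \<le> s" and u: "u \<in> T" "degree (q u) = s"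
  shows "degree (\<Sum>t\<in>T. q t) = s"
proof (rule antisym)
  show "degree (\<Sum>t\<in>T. q t) \<le> s" using T le by (rule degree_sum_le)
  have nonneg: "coeff (q t) s \<ge> 0" if "t \<in> T" for t
  proof (cases "degree (q t) = s")
    case True
    then show ?thesis using q[OF that] by simp
  next
    case False
    then show ?thesis using le[OF that] by (simp add: coeff_eq_0)
  qed
  have "0 < coeff (q u) s" using q[OF u(1)] u(2) by simp
  also have "\<dots> \<le> (\<Sum>t\<in>T. coeff (q t) s)" using u(1) nonneg T by (intro member_le_sum) simp_all
  finally have "coeff (\<Sum>t\<in>T. q t) s \<noteq> 0" by (simp add: coeff_sum)
  then show "s \<le> degree (\<Sum>t\<in>T. q t)" by (rule le_degree)
qed

lemma coloring_orbitE:
  assumes "pair_graph G" "subgroup \<G> (aut_group G)" "X \<in> coloring_orbits G \<G> k"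
  obtains b where "b \<in> X"
    "\<forall>n. orbit_at G n X =
      {d \<in> proper_colorings G n. \<exists>\<sigma> \<in> \<G>. color_classes G d = image \<sigma> ` color_classes G b}"
proof -
  have S: "\<G> \<subseteq> carrier (aut_group G)" using assms(2) by (rule subgroup.subset)
  obtain b where b: "b \<in> proper_colorings G k"
    and X: "X = {d \<in> proper_colorings G k. \<exists>\<sigma> \<in> \<G>. color_classes G d = image \<sigma> ` color_classes G b}"
    using assms(3) unfolding coloring_orbits_eq[OF assms(1) S] by auto
  have "id \<in> \<G>" using subgroup.one_closed[OF assms(2)] by (simp add: aut_group_def)
  then have "b \<in> X" unfolding X using b by (simp add: bexI[where x = id])
  then show ?thesis using that orbit_at_eq[OF assms(1) S b X] by simp
qed

lemma coloring_orbit_classes_closed: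
  assumes G: "pair_graph G" and S: "subgroup \<G> (aut_group G)" and X: "X \<in> coloring_orbits G \<G> k"
    and Z: "Z \<in> color_classes G ` X" and \<tau>: "\<tau> \<in> \<G>"
  shows "image \<tau> ` Z \<in> color_classes G ` X"
proof -
  obtain b where "b \<in> X" and orb: "\<forall>n. orbit_at G n X =
      {d \<in> proper_colorings G n. \<exists>\<sigma> \<in> \<G>. color_classes G d = image \<sigma> ` color_classes G b}"
    by (rule coloring_orbitE[OF G S X])
  have X_eq: "X = {d \<in> proper_colorings G k. \<exists>\<sigma> \<in> \<G>. color_classes G d = image \<sigma> ` color_classes G b}"
    using orbit_at_self[OF G S X] orb by simp
  obtain d \<sigma> where d: "d \<in> proper_colorings G k" "Z = color_classes G d" and \<sigma>: "\<sigma> \<in> \<G>"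
    "color_classes G d = image \<sigma> ` color_classes G b"
    using Z X_eq by auto
  have \<tau>c: "\<tau> \<in> carrier (aut_group G)" using subgroup.subset[OF S] \<tau> by blast
  then have cl: "color_classes G (vertex_action \<tau> d) = image \<tau> ` Z"
    unfolding d(2) by (intro color_classes_vertex_action) (simp add: aut_group_def)
  have "\<tau> \<circ> \<sigma> \<in> \<G>" using subgroup.m_closed[OF S \<tau> \<sigma>(1)] by (simp add: aut_group_def)
  moreover have "image \<tau> ` Z = image (\<tau> \<circ> \<sigma>) ` color_classes G b"
    unfolding d(2) \<sigma>(2) by (simp add: image_image image_comp)
  ultimately have "\<exists>\<sigma>\<in>\<G>. color_classes G (vertex_action \<tau> d) = image \<sigma> ` color_classes G b"
    unfolding cl by blast
  then have "vertex_action \<tau> d \<in> X"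
    unfolding X_eq using vertex_action_proper[OF \<tau>c d(1) G] by (intro CollectI conjI)
  then show ?thesis unfolding cl[symmetric] by (rule imageI)
qed

theorem theorem5p14:
  fixes G :: "('v :: finite) pair_pre_digraph"
    and \<G> :: "('v \<Rightarrow> 'v) set" and N k :: nat and oi oj :: "('v \<Rightarrow> nat) set"
  assumes "pair_graph G"
    and "card (pverts G) = N"
    and "subgroup \<G> (aut_group G)"
    and "k \<ge> N"
    and "oi \<in> coloring_orbits G \<G> k"
    and "oj \<in> coloring_orbits G \<G> k"
  shows
    "(\<exists>(r :: nat) (P :: nat \<Rightarrow> (real ^ 'v) set) H q p.
        (\<forall>m < r. lattice_inside_out_polytope (P m) (H m) \<and>
                 aff_dim (P m) \<le> int (colors_used G oj) \<and>
                 open_ehrhart_polynomial (P m) (H m) (q m)) \<and>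
        (\<exists>m < r. aff_dim (P m) = int (colors_used G oj)) \<and>
        p = (\<Sum>m < r. q m \<circ>\<^sub>p [:1 - real (colors_used G oi), 1:]) \<and>
        degree p = colors_used G oj \<and>
        (\<forall>n \<ge> N. \<forall>c \<in> orbit_at G n oi.
            real (L_count G n c (orbit_at G n oj)) = poly p (real n)))
     \<and> (\<forall>c \<in> oi. \<forall>c' \<in> oi. L_count G k c oj = L_count G k c' oj)
     \<and> (\<forall>c \<in> oi. card oi * L_count G k c oj = chi_count G k oi oj)"
proof -
  note G = assms(1) and S = assms(3)
  interpret pair_graph G by fact
  let ?V = "pverts G" and ?cc = "color_classes G"
  define s where "s = colors_used G oi"
  obtain a where a: "a \<in> oi" and orb_i: "\<forall>n. orbit_at G n oi =
      {d \<in> proper_colorings G n. \<exists>\<sigma> \<in> \<G>. ?cc d = image \<sigma> ` ?cc a}"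
    by (rule coloring_orbitE[OF G S assms(5)])
  have self: "orbit_at G k oi = oi" "orbit_at G k oj = oj"
    using orbit_at_self[OF G S] assms(5,6) by blast+
  have oi_sub: "oi \<subseteq> proper_colorings G k" using self(1) by (auto simp: orbit_at_def)
  have oj_sub: "oj \<subseteq> proper_colorings G k" using self(2) by (auto simp: orbit_at_def)
  have s_eq: "s = card (a ` ?V)" unfolding s_def using colors_used_eq[OF G S assms(5) a] .
  have s_le: "s \<le> N" unfolding s_eq assms(2)[symmetric] by (rule card_image_le) simp
  obtain c1 where c1: "?cc c1 = ?cc a" "c1 ` ?V \<subseteq> {1..s}"
    "\<And>n. s \<le> n \<Longrightarrow> c1 \<in> proper_colorings G n"
    using low_coloring_exists[OF G, of a k] a oi_sub unfolding s_eq by blast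
  have L_eq: "L_count G n c (orbit_at G n oj) = L_count G n c1 (orbit_at G n oj)"
    if n: "n \<ge> N" and c: "c \<in> orbit_at G n oi" for n c
  proof -
    obtain \<sigma> where \<sigma>: "\<sigma> \<in> \<G>" "?cc c = image \<sigma> ` ?cc c1" and c': "c \<in> proper_colorings G n"
      using c unfolding orb_i[rule_format] c1(1) by blast
    have "s \<le> n" using n s_le by simp
    from L_count_cong[OF G S \<sigma>(1) c1(3)[OF this] c' \<sigma>(2) coloring_orbit_classes_closed[OF G S assms(6)]]
    show ?thesis by (simp add: orbit_at_def)
  qed
  have const: "L_count G k c oj = L_count G k c1 oj" if "c \<in> oi" for c
    using L_eq[of k c] that assms(4) self by simp

  define R where "R = inv_into oj ?cc ` ?cc ` oj"
  have R_sub: "R \<subseteq> oj" unfolding R_def by (auto intro: inv_into_into)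
  have R_inj: "inj_on ?cc R" unfolding R_def by (auto simp: inj_on_def f_inv_into_f)
  have R_im: "?cc ` R = ?cc ` oj" unfolding R_def image_image by (auto simp: f_inv_into_f)
  define T where "T = second_types G s c1 R"
  define \<rho> where "\<rho> = (\<lambda>(d0 :: 'v \<Rightarrow> nat, e). card (d0 ` {v \<in> ?V. e v = (0 :: nat)}))"
  have L_sum: "L_count G n c (orbit_at G n oj) = (\<Sum>t\<in>T. \<Prod>i<\<rho> t. (n - s) - i)"
    if n: "n \<ge> N" and c: "c \<in> orbit_at G n oi" for n c
  proof -
    have sn: "s \<le> n" using n s_le by simp
    have "R \<subseteq> proper_colorings G k" using R_sub oj_sub by blast
    from L_count_eq_sum_types[OF G c1(3)[OF sn] c1(2) sn this R_inj]
    have "L_count G n c1 (orbit_at G n oj) = (\<Sum>t\<in>T. \<Prod>i<\<rho> t. (n - s) - i)"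
      by (simp add: orbit_at_def R_im T_def \<rho>_def case_prod_unfold)
    then show ?thesis using L_eq[OF n c] by simp
  qed
  have T_mem: "d0 \<in> oj" if "(d0, e) \<in> T" for d0 e
    using that R_sub by (auto simp: T_def second_types_def)
  have \<rho>_le: "\<rho> t \<le> colors_used G oj" if t: "t \<in> T" for t
  proof -
    obtain d0 e where [simp]: "t = (d0, e)" by (cases t)
    have "d0 ` {v \<in> ?V. e v = 0} \<subseteq> d0 ` ?V" by (intro image_mono) blast
    then have "\<rho> t \<le> card (d0 ` ?V)" unfolding \<rho>_def by (simp add: card_mono)
    moreover have "d0 \<in> oj" using t T_mem by simp
    ultimately show ?thesis using colors_used_eq[OF G S assms(6)] by simp
  qed
  have "finite R"
    by (rule finite_subset[OF subset_trans[OF R_sub oj_sub] finite_proper_colorings[OF pair_finite_verts]])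
  then have finT: "finite T"
    unfolding T_def by (rule finite_second_types[OF pair_finite_verts])
  obtain b where "b \<in> oj" by (rule coloring_orbitE[OF G S assms(6)])
  then have "inv_into oj ?cc (?cc b) \<in> R" unfolding R_def by (intro imageI)
  then obtain d0 where d0: "d0 \<in> R" by blast
  define t0 where "t0 = (d0, \<lambda>v \<in> ?V. 0 :: nat)"
  have t0: "t0 \<in> T"
  proof -
    have "0 \<noteq> c1 v" if "v \<in> ?V" for v using c1(2) that by force
    then show ?thesis using d0 by (simp add: t0_def T_def second_types_def compatible_def)
  qed
  have "{v \<in> ?V. (\<lambda>v \<in> ?V. 0 :: nat) v = 0} = ?V" by auto
  then have \<rho>0: "\<rho> t0 = colors_used G oj"
    using colors_used_eq[OF G S assms(6) subsetD[OF R_sub d0]] by (simp add: \<rho>_def t0_def)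
  have "\<exists>I :: 'v set. card I = \<rho> t" if t: "t \<in> T" for t
  proof -
    obtain d e where [simp]: "t = (d, e)" by (cases t)
    have "\<rho> t \<le> card {v \<in> ?V. e v = 0}" unfolding \<rho>_def by (simp add: card_image_le)
    then obtain J where "J \<subseteq> {v \<in> ?V. e v = 0}" "card J = \<rho> t" "finite J" by (rule obtain_subset_with_card_n)
    then show ?thesis by blast
  qed
  then obtain I :: "('v \<Rightarrow> nat) \<times> ('v \<Rightarrow> nat) \<Rightarrow> 'v set" where I: "\<And>t. t \<in> T \<Longrightarrow> card (I t) = \<rho> t"
    by metis
  obtain h where h: "bij_betw h {..<card T} T"
    using ex_bij_betw_nat_finite[OF finT] by (auto simp: lessThan_atLeast0)
  have hT: "h m \<in> T" if "m < card T" for m using bij_betwE[OF h] that by blast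
  obtain m0 where m0: "m0 < card T" "h m0 = t0"
  proof -
    have "t0 \<in> h ` {..<card T}" using t0 bij_betw_imp_surj_on[OF h] by simp
    then show ?thesis using that by blast
  qed
  define q where "q = (\<lambda>m. ff_poly (\<rho> (h m)))"
  define p where "p = (\<Sum>m < card T. q m \<circ>\<^sub>p [:1 - real s, 1:])"
  have deg_q: "degree (q m \<circ>\<^sub>p [:1 - real s, 1:]) = \<rho> (h m)" for m
    by (simp add: q_def degree_pcompose degree_ff_poly)
  have deg_p: "degree p = colors_used G oj"
    unfolding p_def
  proof (rule degree_sum_monic[where u = m0])
    show "lead_coeff (q m \<circ>\<^sub>p [:1 - real s, 1:]) = 1" for m
      by (subst lead_coeff_comp) (simp_all add: q_def lead_coeff_ff_poly)
  qed (use m0 hT \<rho>_le in \<open>auto simp: deg_q \<rho>0\<close>)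
  have eval: "real (L_count G n c (orbit_at G n oj)) = poly p (real n)"
    if n: "n \<ge> N" and c: "c \<in> orbit_at G n oi" for n c
  proof -
    have "poly (q m \<circ>\<^sub>p [:1 - real s, 1:]) (real n) = real (\<Prod>i<\<rho> (h m). (n - s) - i)" for m
    proof -
      have "1 - real s + real n = real (n - s + 1)" using n s_le by simp
      then have "poly (q m \<circ>\<^sub>p [:1 - real s, 1:]) (real n) = poly (q m) (real (n - s + 1))"
        by (simp only: poly_pcompose poly_pCons poly_0 mult_zero_right mult_1_right add_0_right)
      also have "\<dots> = real (\<Prod>i<\<rho> (h m). (n - s + 1 - 1) - i)"
        unfolding q_def by (rule poly_ff_poly) simp
      finally show ?thesis by (simp only: add_diff_cancel_right')
    qed
    then have "poly p (real n) = (\<Sum>m<card T. real (\<Prod>i<\<rho> (h m). (n - s) - i))"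
      by (simp add: p_def poly_sum)
    also have "\<dots> = (\<Sum>t\<in>T. real (\<Prod>i<\<rho> t. (n - s) - i))"
      by (rule sum.reindex_bij_betw[OF h])
    finally show ?thesis using L_sum[OF n c] by simp
  qed
  show ?thesis
  proof (intro conjI)
    show "\<exists>(r :: nat) (P :: nat \<Rightarrow> (real ^ 'v) set) H q p.
        (\<forall>m < r. lattice_inside_out_polytope (P m) (H m) \<and>
                 aff_dim (P m) \<le> int (colors_used G oj) \<and>
                 open_ehrhart_polynomial (P m) (H m) (q m)) \<and>
        (\<exists>m < r. aff_dim (P m) = int (colors_used G oj)) \<and>
        p = (\<Sum>m < r. q m \<circ>\<^sub>p [:1 - real (colors_used G oi), 1:]) \<and>
        degree p = colors_used G oj \<and>
        (\<forall>n \<ge> N. \<forall>c \<in> orbit_at G n oi.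
            real (L_count G n c (orbit_at G n oj)) = poly p (real n))"
    proof (rule exI[of _ "card T"], rule exI[of _ "\<lambda>m. coord_cube (I (h m))"],
        rule exI[of _ "\<lambda>m. braid_arrangement (I (h m))"], rule exI[of _ q], rule exI[of _ p],
        intro conjI allI impI ballI)
      fix m assume "m < card T"
      note m = hT[OF this]
      show "lattice_inside_out_polytope (coord_cube (I (h m))) (braid_arrangement (I (h m)))"
        by (rule lattice_inside_out_polytope_coord_cube)
      show "aff_dim (coord_cube (I (h m))) \<le> int (colors_used G oj)"
        using \<rho>_le[OF m] I[OF m] by (simp add: aff_dim_coord_cube)
      show "open_ehrhart_polynomial (coord_cube (I (h m))) (braid_arrangement (I (h m))) (q m)"
        using open_ehrhart_polynomial_coord_cube[of "I (h m)"] I[OF m] by (simp add: q_def)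
    next
      have "aff_dim (coord_cube (I (h m0))) = int (colors_used G oj)"
        using I[OF t0] \<rho>0 m0(2) by (simp add: aff_dim_coord_cube)
      with m0(1) show "\<exists>m<card T. aff_dim (coord_cube (I (h m))) = int (colors_used G oj)"
        by blast
    next
      show "p = (\<Sum>m < card T. q m \<circ>\<^sub>p [:1 - real (colors_used G oi), 1:])"
        by (simp only: p_def s_def)
    qed (rule deg_p eval; assumption)+
    show "\<forall>c \<in> oi. \<forall>c' \<in> oi. L_count G k c oj = L_count G k c' oj"
      using const by simp
    show "\<forall>c \<in> oi. card oi * L_count G k c oj = chi_count G k oi oj"
      using const by (simp add: chi_count_eq_sum[OF G oi_sub oj_sub])
  qed
qed

end
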